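(* Let $I$ be an instance of Setwise-Disjoint Facility Location on an arc-weighted, strongly connected directed graph $G=(V,A)$ with customers $C\subseteq F\subseteq V$, and let $\mathrm{OPT}(I)$ be a minimum-size setwise-disjoint cover. Let $X(I)\subseteq F$ be the hitting set produced by the greedy hitting set heuristic described below, and let $\mathrm{SHS}(I)$ be any setwise-disjoint cover obtained from $X(I)$ by adding and/or removing facilities, with $\Delta=|\mathrm{SHS}(I)|-|X(I)|$. Then $$|\mathrm{SHS}(I)|\le (\ln(|A|)+1)\cdot|\mathrm{OPT}(I)|+\Delta.$$
   Context: For $c\in C$ and $f\in F$, $P(c,f)$ is the set of shortest (minimum-weight) directed paths from $c$ to $f$. A pair $\{f_1,f_2\}\subseteq F\setminus\{c\}$ covers $c$ in a setwise-disjoint fashion if no path in $P(c,f_1)$ shares a vertex other than $c$ with any path in $P(c,f_2)$; $F'\subseteq F$ is a setwise-disjoint cover if every $c\in C\setminus F'$ is so covered by a pair in $F'\setminus\{c\}$. Let $N(c)=\{x:(c,x)\in A\}$ and, for $f\ne c$, let $N(c,f)\subseteq N(c)$ be the set of neighbors of $c$ lying on some path in $P(c,f)$. A facility $f\in F$ hits a pair $(c,x)$ with $c\in C$, $x\in N(c)$ if $f=c$ or $x\notin N(c,f)$. The greedy hitting set heuristic starts with $X=\emptyset$ and, while some pair $(c,x)$ ($c\in C$, $x\in N(c)$) is not hit by any member of $X$, adds to $X$ a facility in $F$ that hits the largest number of not-yet-hit pairs (ties broken arbitrarily). *)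

theory Defs
  imports Complex_Main "Graph_Theory.Graph_Theory"
begin

(* The locale digraph provides finite digraphs without loops and without parallel arcs, so arcs
   correspond to pairs of distinct vertices. A loop at c would have to be excluded in any case: c lies
   on every path starting in c, so the pair (c, c) could be hit only by c itself.
   Arc weights are arbitrary reals: shortest paths are taken among the finitely many simple paths,
   hence they exist without any assumption on the sign of the weights. *)
locale facility_location = digraph G for G :: "('a, 'b) pre_digraph" (structure) +
  fixes w :: "'b weight_fun" and C F :: "'a set"
  assumes strongly_connected: "strongly_connected G"
    and customers_subset: "C \<subseteq> F"
    and facilities_subset: "F \<subseteq> verts G"
begin

definition shortest_paths :: "'a \<Rightarrow> 'a \<Rightarrow> 'b awalk set" where
  "shortest_paths c f = {p. is_arg_min (awalk_cost w) (\<lambda>q. apath c q f) p}"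

definition covers :: "'a \<Rightarrow> 'a \<Rightarrow> 'a \<Rightarrow> bool" where
  "covers f1 f2 c \<longleftrightarrow> f1 \<in> F - {c} \<and> f2 \<in> F - {c} \<and> f1 \<noteq> f2 \<and>
     (\<forall>p \<in> shortest_paths c f1. \<forall>q \<in> shortest_paths c f2.
        set (awalk_verts c p) \<inter> set (awalk_verts c q) \<subseteq> {c})"

definition setwise_disjoint_cover :: "'a set \<Rightarrow> bool" where
  "setwise_disjoint_cover F' \<longleftrightarrow> F' \<subseteq> F \<and>
     (\<forall>c \<in> C - F'. \<exists>f1 \<in> F' - {c}. \<exists>f2 \<in> F' - {c}. covers f1 f2 c)"

definition minimum_cover :: "'a set \<Rightarrow> bool" where
  "minimum_cover S \<longleftrightarrow> is_arg_min card setwise_disjoint_cover S"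

definition neighbors :: "'a \<Rightarrow> 'a set" where
  "neighbors c = {x. c \<rightarrow> x}"

definition path_neighbors :: "'a \<Rightarrow> 'a \<Rightarrow> 'a set" where
  "path_neighbors c f =
     {x \<in> neighbors c. \<exists>p \<in> shortest_paths c f. x \<in> set (awalk_verts c p)}"

definition hits :: "'a \<Rightarrow> 'a \<times> 'a \<Rightarrow> bool" where
  "hits f = (\<lambda>(c, x). f = c \<or> x \<notin> path_neighbors c f)"

definition unhit_pairs :: "'a set \<Rightarrow> ('a \<times> 'a) set" where
  "unhit_pairs X = {e \<in> Sigma C neighbors. \<forall>f \<in> X. \<not> hits f e}"

inductive greedy_reachable :: "'a set \<Rightarrow> bool" where
  start: "greedy_reachable {}"
| step: "greedy_reachable X \<Longrightarrow> unhit_pairs X \<noteq> {} \<Longrightarrow>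
    is_arg_max (\<lambda>g. card {e \<in> unhit_pairs X. hits g e}) (\<lambda>g. g \<in> F) f \<Longrightarrow>
    greedy_reachable (insert f X)"

(* Ties are broken arbitrarily, so the heuristic has a set of possible outcomes. *)
definition greedy_hitting_set :: "'a set \<Rightarrow> bool" where
  "greedy_hitting_set X \<longleftrightarrow> greedy_reachable X \<and> unhit_pairs X = {}"

end

end

theory Submission
  imports Defs "HOL-Analysis.Harmonic_Numbers"
begin

text \<open>
  A setwise-disjoint cover hits every pair: a neighbor of \<open>c\<close> lying on shortest paths to both
  facilities covering \<open>c\<close> would be a common vertex other than \<open>c\<close>. So if \<open>k\<close> is the size of a
  minimum cover and \<open>u\<close> pairs are unhit, some facility hits at least \<open>u / k\<close> of them, and hence so
  does the greedy choice. Such a step lowers the harmonic number \<open>harm u\<close> by at least \<open>1 / k\<close>;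
  the greedy set thus has size at most \<open>k * harm u\<^sub>0\<close>, where \<open>u\<^sub>0\<close>, the number of all pairs, is
  at most the number of arcs.
\<close>

text \<open>Each of the \<open>n - m\<close> reciprocals summed between \<open>m\<close> and
  \<open>n\<close> is at least \<open>1 / n\<close>.\<close>

lemma harm_diff_ge:
  assumes "m \<le> n"
  shows "real (n - m) / real n \<le> harm n - harm m"
proof -
  have "real (n - m) / real n = (\<Sum>k\<in>{m<..n}. inverse (real n))"
    by (simp add: field_simps)
  also have "\<dots> \<le> (\<Sum>k\<in>{m<..n}. inverse (real k))"
    by (intro sum_mono) (auto intro!: le_imp_inverse_le)
  also have "\<dots> = (\<Sum>k\<in>{1..n} - {1..m}. inverse (real k))"
    by (intro sum.cong) auto
  also have "\<dots> = harm n - harm m"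
    unfolding harm_def using assms by (subst sum_diff) auto
  finally show ?thesis .
qed

context facility_location
begin

lemma pairs_subset_arcs_ends: "Sigma C neighbors \<subseteq> arcs_ends G"
  by (auto simp: neighbors_def)

lemma finite_pairs: "finite (Sigma C neighbors)"
  by (rule finite_subset[OF pairs_subset_arcs_ends]) (simp add: arcs_ends_def)

lemma card_pairs_le: "card (Sigma C neighbors) \<le> card (arcs G)"
proof -
  have "card (Sigma C neighbors) \<le> card (arcs_ends G)"
    by (intro card_mono pairs_subset_arcs_ends) (simp add: arcs_ends_def)
  also have "\<dots> \<le> card (arcs G)"
    unfolding arcs_ends_def by (rule card_image_le) simp
  finally show ?thesis .
qed

lemma finite_unhit_pairs: "finite (unhit_pairs X)"
  unfolding unhit_pairs_def by (rule finite_subset[OF _ finite_pairs]) auto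

lemma unhit_pairs_empty: "unhit_pairs {} = Sigma C neighbors"
  by (simp add: unhit_pairs_def)

lemma unhit_pairs_insert: "unhit_pairs (insert f X) = unhit_pairs X - {e \<in> unhit_pairs X. hits f e}"
  by (auto simp: unhit_pairs_def)

lemma covers_imp_hits:
  assumes "covers f1 f2 c" and "x \<in> neighbors c"
  shows "hits f1 (c, x) \<or> hits f2 (c, x)"
proof (rule ccontr)
  assume "\<not> ?thesis"
  then obtain p q where "p \<in> shortest_paths c f1" "q \<in> shortest_paths c f2"
    "x \<in> set (awalk_verts c p) \<inter> set (awalk_verts c q)"
    by (auto simp: hits_def path_neighbors_def)
  with assms(1) have "x = c"
    unfolding covers_def by blast
  \<comment> \<open>The digraph has no loops, so a neighbor of \<open>c\<close> differs from
    \<open>c\<close>.\<close>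
  with assms(2) show False
    by (auto simp: neighbors_def dest: adj_not_same)
qed

lemma setwise_disjoint_cover_imp_hitting_set:
  assumes "setwise_disjoint_cover S"
  shows "unhit_pairs S = {}"
proof -
  have "\<exists>f\<in>S. hits f (c, x)" if "c \<in> C" "x \<in> neighbors c" for c x
  proof (cases "c \<in> S")
    \<comment> \<open>A customer in \<open>S\<close> is exempt from the covering condition, but it
      hits all of its own pairs.\<close>
    case True
    then show ?thesis by (auto simp: hits_def)
  next
    case False
    with assms that(1) obtain f1 f2 where "f1 \<in> S" "f2 \<in> S" "covers f1 f2 c"
      unfolding setwise_disjoint_cover_def by blast
    with covers_imp_hits that(2) show ?thesis by blast
  qed
  then show ?thesis by (auto simp: unhit_pairs_def)
qed

text \<open>Averaging: together the members of \<open>S\<close> hit all pairs still unhit by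
  \<open>X\<close>, and none of them hits more than the greedy choice \<open>f\<close>. The product
  form avoids dividing by \<open>card S\<close>, which is zero for empty \<open>S\<close>.\<close>

lemma card_unhit_pairs_le_greedy:
  assumes "S \<subseteq> F" and "unhit_pairs S = {}"
    and f: "is_arg_max (\<lambda>g. card {e \<in> unhit_pairs X. hits g e}) (\<lambda>g. g \<in> F) f"
  shows "card (unhit_pairs X) \<le> card S * card {e \<in> unhit_pairs X. hits f e}"
proof -
  let ?H = "\<lambda>g. {e \<in> unhit_pairs X. hits g e}"
  have fin: "finite S"
    using assms(1) facilities_subset finite_verts by (meson finite_subset)
  have "unhit_pairs X \<subseteq> (\<Union>g\<in>S. ?H g)"
    using assms(2) by (auto simp: unhit_pairs_def)
  then have "card (unhit_pairs X) \<le> card (\<Union>g\<in>S. ?H g)"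
    using fin by (intro card_mono) (auto simp: finite_unhit_pairs)
  also have "\<dots> \<le> (\<Sum>g\<in>S. card (?H g))"
    by (rule card_UN_le[OF fin])
  also have "\<dots> \<le> (\<Sum>g\<in>S. card (?H f))"
    using f assms(1) by (intro sum_mono) (auto simp: is_arg_max_linorder)
  finally show ?thesis by simp
qed

text \<open>Invariant of a greedy run: \<open>card S\<close> times the drop in the harmonic number
  pays one unit per facility chosen. Finiteness of \<open>X\<close> is carried along so that
  \<open>card\<close> of an insertion can be computed.\<close>

lemma card_greedy_le_harm_diff:
  assumes "S \<subseteq> F" and "unhit_pairs S = {}" and "greedy_reachable X"
  shows "finite X \<and>
    real (card X) \<le> real (card S) * (harm (card (Sigma C neighbors)) - harm (card (unhit_pairs X)))"
  using assms(3)
proof induction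
  case start
  then show ?case by (simp add: unhit_pairs_empty)
next
  case (step X f)
  define u where "u = card (unhit_pairs X)"
  define m where "m = card {e \<in> unhit_pairs X. hits f e}"
  have u: "u > 0"
    using step.hyps(2) finite_unhit_pairs by (simp add: u_def card_gt_0_iff)
  have m: "m \<le> u"
    unfolding u_def m_def using finite_unhit_pairs by (intro card_mono) auto
  have u': "card (unhit_pairs (insert f X)) = u - m"
    unfolding unhit_pairs_insert u_def m_def
    by (rule card_Diff_subset) (auto simp: finite_unhit_pairs)
  have "u \<le> card S * m"
    unfolding u_def m_def by (rule card_unhit_pairs_le_greedy[OF assms(1,2) step.hyps(3)])
  then have "real u \<le> real (card S) * real m"
    by (metis of_nat_le_iff of_nat_mult)
  \<comment> \<open>Division by \<open>u\<close> is allowed because the greedy rule acts only while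
    some pair is unhit.\<close>
  then have "1 \<le> real (card S) * (real m / real u)"
    using u by (simp add: field_simps)
  also have "\<dots> \<le> real (card S) * (harm u - harm (u - m))"
    using harm_diff_ge[of "u - m" u] m by (intro mult_left_mono) auto
  finally have "1 \<le> real (card S) * (harm u - harm (u - m))" .
  moreover have "real (card (insert f X)) \<le> real (card X) + 1"
    using step.IH by (simp add: card_insert_if)
  ultimately show ?case
    using step.IH unfolding u' by (simp add: u_def algebra_simps)
qed

theorem card_greedy_hitting_set_le:
  assumes "setwise_disjoint_cover S" and "greedy_hitting_set X"
  shows "real (card X) \<le> (ln (real (card (arcs G))) + 1) * real (card S)"
proof -
  let ?n = "card (Sigma C neighbors)"
  have "real (card X) \<le> real (card S) * (harm ?n - harm (card (unhit_pairs X)))"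
    using card_greedy_le_harm_diff[of S X] setwise_disjoint_cover_imp_hitting_set assms
    by (auto simp: greedy_hitting_set_def setwise_disjoint_cover_def)
  then have X: "real (card X) \<le> real (card S) * harm ?n"
    using assms(2) by (simp add: greedy_hitting_set_def harm_expand)
  have "harm ?n \<le> ln (real (card (arcs G))) + 1"
  \<comment> \<open>Without pairs the left side is 0. The right side is then positive even for a
    graph without arcs, since \<open>ln 0 = 0\<close> by convention.\<close>
  proof (cases "?n = 0")
    case True
    then show ?thesis
      by (cases "card (arcs G) = 0")
        (simp_all add: harm_expand Suc_le_eq card_gt_0_iff add_nonneg_nonneg)
  next
    case False
    \<comment> \<open>The sequence \<open>harm n - ln n\<close> decreases from its value 1 at
      \<open>n = 1\<close>.\<close>
    then have "harm ?n \<le> ln (real ?n) + 1"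
      using euler_mascheroni_sequence_decreasing[of 1 ?n] by (simp add: harm_expand)
    also have "ln (real ?n) \<le> ln (real (card (arcs G)))"
      using False card_pairs_le by simp
    finally show ?thesis by simp
  qed
  then have "real (card S) * harm ?n \<le> real (card S) * (ln (real (card (arcs G))) + 1)"
    by (rule mult_left_mono) simp
  with X show ?thesis by (simp add: mult.commute)
qed

end

theorem theorem4:
  fixes G :: "('a, 'b) pre_digraph" and w :: "'b weight_fun"
    and C F OPT X SHS Added Removed :: "'a set" and \<Delta> :: int
  assumes "facility_location G C F"
    and "facility_location.minimum_cover G w C F OPT"
    and "facility_location.greedy_hitting_set G w C F X"
    and "Removed \<subseteq> X" and "Added \<subseteq> F" and "SHS = (X - Removed) \<union> Added"
    and "facility_location.setwise_disjoint_cover G w C F SHS"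
    and "\<Delta> = int (card SHS) - int (card X)"
  shows "real (card SHS) \<le> (ln (real (card (arcs G))) + 1) * real (card OPT) + real_of_int \<Delta>"
proof -
  interpret facility_location G w C F
    by (rule assms(1))
  have "setwise_disjoint_cover OPT"
    using assms(2) by (simp add: minimum_cover_def is_arg_min_def)
  \<comment> \<open>Since \<open>card SHS\<close> equals \<open>card X\<close> plus
    \<open>\<Delta>\<close>, the goal is the bound on \<open>card X\<close> shifted by
    \<open>\<Delta>\<close>.\<close>
  from card_greedy_hitting_set_le[OF this assms(3)] show ?thesis
    by (simp add: assms(8))
qed

end
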